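(* In the setting of the context, $\lambda_{\min}(P)$ and $\lambda_{\max}(P)$ are also (respectively) the largest and smallest constants such that either one of the following conditions holds: (a) for all $\varphi\in\mathcal B^*$, $$\lambda_{\min}(P)\sup_{\chi'\in\mathfrak V^\perp}\frac{[\varphi,\chi']^2}{\|\chi'\|^2}\le\sum_{i\in\beth}\sup_{\chi'\in\mathfrak V_i^\perp}\frac{[\varphi,\chi']^2}{\|\chi'\|^2}\le\lambda_{\max}(P)\sup_{\chi'\in\mathfrak V^\perp}\frac{[\varphi,\chi']^2}{\|\chi'\|^2};$$ (b) for all $\varphi\in\mathcal B^*$, $$\lambda_{\min}(P)\inf_{\phi\in\Phi}\|\varphi-\phi\|_*^2\le\sum_{i\in\beth}\inf_{\phi\in\Phi}\|\mathcal R_i(\varphi-\phi)\|_{*,i}^2\le\lambda_{\max}(P)\inf_{\phi\in\Phi}\|\varphi-\phi\|_*^2.$$ (That is, the optimal constants in (a), and likewise the optimal constants in (b), are $\lambda_{\min}(P)$ and $\lambda_{\max}(P)$.)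
   Context: $(\mathcal B,\|\cdot\|)$ is a reflexive separable Banach space with dual $\mathcal B^*$ and pairing $[\cdot,\cdot]$, with $\|u\|^2=[Q^{-1}u,u]$ for a symmetric positive bijective linear operator $Q:\mathcal B^*\to\mathcal B$, $\langle u,v\rangle:=[Q^{-1}u,v]$, and dual norm $\|\phi\|_*=[\phi,Q\phi]^{1/2}$. $\aleph=\{1,\dots,|\aleph|\}$ and $\beth=\{1,\dots,|\beth|\}$ are finite index sets, $(\phi_{i,\alpha})_{(i,\alpha)\in\beth\times\aleph}$ are linearly independent elements of $\mathcal B^*$, with span $\Phi$. For $i\in\beth$, $\mathcal B_i\subset\mathcal B$ are closed subspaces with the induced norm $\|\cdot\|_i$ such that (1) $\mathcal B=\mathcal B_1+\cdots+\mathcal B_{|\beth|}$ (not necessarily direct) and (2) for each $(i,\alpha)$ there is $\tilde\psi_{i,\alpha}\in\mathcal B_i$ with $[\phi_{j,\beta},\tilde\psi_{i,\alpha}]=\delta_{i,j}\delta_{\alpha,\beta}$ for all $(j,\beta)$. $\mathfrak V^\perp:=\{\psi\in\mathcal B:[\phi_{i,\alpha},\psi]=0\ \forall(i,\alpha)\}$, $\mathfrak V^\perp_i:=\mathcal B_i\cap\mathfrak V^\perp$; $P_i$ is the $\langle\cdot,\cdot\rangle$-orthogonal projection of $\mathcal B$ onto $\mathfrak V^\perp_i$, $P:=\sum_{i\in\beth}P_i$. $\lambda_{\min}(P)$ and $\lambda_{\max}(P)$ are defined as the largest and smallest constants with $\lambda_{\min}(P)\|\chi\|^2\le\langle\chi,P\chi\rangle\le\lambda_{\max}(P)\|\chi\|^2$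 for all $\chi\in\mathfrak V^\perp$. $\|\varphi\|_{*,i}:=\sup_{\psi\in\mathcal B_i}[\varphi,\psi]/\|\psi\|_i$ is the dual norm on $\mathcal B_i^*$, and $\mathcal R_i:\mathcal B^*\to\mathcal B_i^*$ is restriction: $[\mathcal R_i\varphi,\psi]=[\varphi,\psi]$ for $\psi\in\mathcal B_i$. Suprema of quotients are over nonzero elements (and are $0$ if there are none). *)

theory Defs
  imports "HOL-Analysis.Analysis"
begin

text \<open>
  The dual of the Banach space \<open>'b\<close> is the type \<open>'b \<Rightarrow>\<^sub>L real\<close>, and the pairing of a functional
  with a vector is \<^const>\<open>blinfun_apply\<close>.
\<close>

definition reflexive_space :: "'b::real_normed_vector itself \<Rightarrow> bool" where
  "reflexive_space _ \<longleftrightarrow>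
     (\<forall>F :: ('b \<Rightarrow>\<^sub>L real) \<Rightarrow>\<^sub>L real. \<exists>u::'b. \<forall>f :: 'b \<Rightarrow>\<^sub>L real.
        blinfun_apply F f = blinfun_apply f u)"

definition separable :: "'b::topological_space itself \<Rightarrow> bool" where
  "separable _ \<longleftrightarrow> (\<exists>D :: 'b set. countable D \<and> closure D = UNIV)"

definition indexed_independent :: "('k \<Rightarrow> 'v::real_vector) \<Rightarrow> 'k set \<Rightarrow> bool" where
  "indexed_independent v K \<longleftrightarrow> inj_on v K \<and> independent (v ` K)"

definition Qinner :: "(('b::real_normed_vector \<Rightarrow>\<^sub>L real) \<Rightarrow> 'b) \<Rightarrow> 'b \<Rightarrow> 'b \<Rightarrow> real" where
  "Qinner Q u v = blinfun_apply (inv Q u) v"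

definition dual_norm :: "(('b::real_normed_vector \<Rightarrow>\<^sub>L real) \<Rightarrow> 'b) \<Rightarrow> ('b \<Rightarrow>\<^sub>L real) \<Rightarrow> real" where
  "dual_norm Q \<phi> = sqrt (blinfun_apply \<phi> (Q \<phi>))"

text \<open>Supremum over the nonzero elements of \<open>S\<close>, with the convention that it is 0 if there are none.\<close>

definition Sup_nonzero :: "'b::real_vector set \<Rightarrow> ('b \<Rightarrow> real) \<Rightarrow> real" where
  "Sup_nonzero S f = (if S - {0} = {} then 0 else (SUP x \<in> S - {0}. f x))"

text \<open>
  Functionals on a subspace \<open>S\<close> are represented by functions that are \<^const>\<open>undefined\<close> outside
  \<open>S\<close>, as produced by \<^const>\<open>restrict\<close>.
\<close>

definition restr :: "'b::real_normed_vector set \<Rightarrow> ('b \<Rightarrow>\<^sub>L real) \<Rightarrow> ('b \<Rightarrow> real)" where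
  "restr S \<phi> = restrict (blinfun_apply \<phi>) S"

definition sub_dual_norm :: "'b::real_normed_vector set \<Rightarrow> ('b \<Rightarrow> real) \<Rightarrow> real" where
  "sub_dual_norm S f = Sup_nonzero S (\<lambda>\<psi>. f \<psi> / norm \<psi>)"

definition measurement_span :: "nat \<Rightarrow> nat \<Rightarrow> (nat \<Rightarrow> nat \<Rightarrow> 'b::real_normed_vector \<Rightarrow>\<^sub>L real)
    \<Rightarrow> ('b \<Rightarrow>\<^sub>L real) set" where
  "measurement_span m n \<phi> = span {\<phi> i \<alpha> | i \<alpha>. i \<in> {1..m} \<and> \<alpha> \<in> {1..n}}"

definition Vperp :: "nat \<Rightarrow> nat \<Rightarrow> (nat \<Rightarrow> nat \<Rightarrow> 'b::real_normed_vector \<Rightarrow>\<^sub>L real) \<Rightarrow> 'b set" where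
  "Vperp m n \<phi> = {\<psi>. \<forall>i\<in>{1..m}. \<forall>\<alpha>\<in>{1..n}. blinfun_apply (\<phi> i \<alpha>) \<psi> = 0}"

definition orth_proj :: "(('b::real_normed_vector \<Rightarrow>\<^sub>L real) \<Rightarrow> 'b) \<Rightarrow> 'b set \<Rightarrow> 'b \<Rightarrow> 'b" where
  "orth_proj Q S u = (THE v. v \<in> S \<and> (\<forall>w\<in>S. Qinner Q (u - v) w = 0))"

definition Psum :: "(('b::real_normed_vector \<Rightarrow>\<^sub>L real) \<Rightarrow> 'b) \<Rightarrow> nat \<Rightarrow> nat
    \<Rightarrow> (nat \<Rightarrow> nat \<Rightarrow> 'b \<Rightarrow>\<^sub>L real) \<Rightarrow> (nat \<Rightarrow> 'b set) \<Rightarrow> 'b \<Rightarrow> 'b" where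
  "Psum Q m n \<phi> B u = (\<Sum>i\<in>{1..m}. orth_proj Q (B i \<inter> Vperp m n \<phi>) u)"

definition is_largest :: "'a::order \<Rightarrow> ('a \<Rightarrow> bool) \<Rightarrow> bool" where
  "is_largest c C \<longleftrightarrow> C c \<and> (\<forall>c'. C c' \<longrightarrow> c' \<le> c)"

definition is_smallest :: "'a::order \<Rightarrow> ('a \<Rightarrow> bool) \<Rightarrow> bool" where
  "is_smallest c C \<longleftrightarrow> C c \<and> (\<forall>c'. C c' \<longrightarrow> c \<le> c')"

text \<open>
  The extreme constants of an operator \<open>T\<close> on a subspace \<open>V\<close> are defined as relations rather than
  functions: for \<open>V = {0}\<close> every constant is admissible, so no largest or smallest one exists.
\<close>

definition is_lambda_min :: "(('b::real_normed_vector \<Rightarrow>\<^sub>L real) \<Rightarrow> 'b) \<Rightarrow> 'b set \<Rightarrow> ('b \<Rightarrow> 'b)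
    \<Rightarrow> real \<Rightarrow> bool" where
  "is_lambda_min Q V T l \<longleftrightarrow>
     is_largest l (\<lambda>c. \<forall>x\<in>V. c * (norm x)\<^sup>2 \<le> Qinner Q x (T x))"

definition is_lambda_max :: "(('b::real_normed_vector \<Rightarrow>\<^sub>L real) \<Rightarrow> 'b) \<Rightarrow> 'b set \<Rightarrow> ('b \<Rightarrow> 'b)
    \<Rightarrow> real \<Rightarrow> bool" where
  "is_lambda_max Q V T l \<longleftrightarrow>
     is_smallest l (\<lambda>c. \<forall>x\<in>V. Qinner Q x (T x) \<le> c * (norm x)\<^sup>2)"

definition quot_sup :: "'b::real_normed_vector set \<Rightarrow> ('b \<Rightarrow>\<^sub>L real) \<Rightarrow> real" where
  "quot_sup S \<phi> = Sup_nonzero S (\<lambda>x. (blinfun_apply \<phi> x)\<^sup>2 / (norm x)\<^sup>2)"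

end

theory Submission
  imports Defs
begin

text \<open>
  By Riesz, \<open>f = \<langle>Q f, \<cdot>\<rangle>\<close>, so the squared norm of \<open>f\<close> restricted to a closed subspace \<open>S\<close> is
  \<open>\<parallel>p\<^sub>S (Q f)\<parallel>\<^sup>2\<close>, with \<open>p\<^sub>S\<close> the orthogonal projection. With \<open>\<chi> = p\<^sub>V (Q f)\<close>, which ranges over all
  of \<open>V\<close>, the sums in (a) are \<open>\<Sum>\<^sub>i \<parallel>P\<^sub>i \<chi>\<parallel>\<^sup>2 = \<langle>\<chi>, P \<chi>\<rangle>\<close>, so (a) is the condition defining
  the extreme constants of \<open>P\<close>. Condition (b) coincides with (a) term by term: a functional on \<open>S\<close>
  vanishing on \<open>S \<inter> V\<close> is on \<open>S\<close> a combination of the measurements, hence the distance of \<open>f\<close>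
  to \<open>\<Phi>\<close> in the dual of \<open>S\<close> is the norm of \<open>f\<close> on \<open>S \<inter> V\<close>.
\<close>

section \<open>Functionals vanishing on a common kernel\<close>

text \<open>Each \<psi> k cuts \<open>S\<close> down to a kernel of codimension at most one, so a
  combination that is correct on the kernel needs only a multiple of \<psi> k to become correct on
  \<open>S\<close>. The induction hypothesis is applied to that kernel, hence \<open>S\<close> is
  kept arbitrary.\<close>

lemma vanishing_on_kernels_imp_span:
  fixes \<psi> :: "'k \<Rightarrow> 'b::real_normed_vector \<Rightarrow>\<^sub>L real"
  assumes "finite K" "subspace S"
    and "\<And>x. x \<in> S \<Longrightarrow> (\<forall>k\<in>K. blinfun_apply (\<psi> k) x = 0) \<Longrightarrow> blinfun_apply h x = 0"
  shows "\<exists>g\<in>span (\<psi> ` K). \<forall>x\<in>S. blinfun_apply h x = blinfun_apply g x"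
  using assms
proof (induction K arbitrary: S rule: finite_induct)
  case empty
  then show ?case by auto
next
  case (insert k K)
  define S' where "S' = {x\<in>S. blinfun_apply (\<psi> k) x = 0}"
  have S': "subspace S'"
    using insert.prems(1) by (auto simp: S'_def subspace_def blinfun.bilinear_simps)
  have "\<exists>g\<in>span (\<psi> ` K). \<forall>x\<in>S'. blinfun_apply h x = blinfun_apply g x"
    by (rule insert.IH[OF S']) (use insert.prems(2) in \<open>auto simp: S'_def\<close>)
  then obtain g where g: "g \<in> span (\<psi> ` K)" "\<And>x. x \<in> S' \<Longrightarrow> blinfun_apply h x = blinfun_apply g x"
    by blast
  have g': "g \<in> span (\<psi> ` insert k K)"
    using g(1) span_mono[of "\<psi> ` K" "\<psi> ` insert k K"] by auto
  show ?case
  proof (cases "S' = S")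
    case True
    then show ?thesis using g g' by auto
  next
    case False
    then obtain y where y: "y \<in> S" "blinfun_apply (\<psi> k) y \<noteq> 0"
      by (auto simp: S'_def)
    \<comment> \<open>This value makes \<open>g + c *\<^sub>R \<psi> k\<close> agree with
      \<open>h\<close> at \<open>y\<close>; every vector of \<open>S\<close> is a multiple of
      \<open>y\<close> plus an element of \<open>S'\<close>.\<close>
    define c where "c = (blinfun_apply h y - blinfun_apply g y) / blinfun_apply (\<psi> k) y"
    show ?thesis
    proof (intro bexI ballI)
      show "g + c *\<^sub>R \<psi> k \<in> span (\<psi> ` insert k K)"
        by (intro span_add g' span_scale span_base) auto
      fix x assume x: "x \<in> S"
      let ?t = "blinfun_apply (\<psi> k) x / blinfun_apply (\<psi> k) y"
      have "x - ?t *\<^sub>R y \<in> S'"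
        using x y insert.prems(1)
        by (auto simp: S'_def blinfun.bilinear_simps subspace_diff subspace_scale)
      from g(2)[OF this] show "blinfun_apply h x = blinfun_apply (g + c *\<^sub>R \<psi> k) x"
        by (simp add: blinfun.bilinear_simps c_def algebra_simps diff_divide_distrib)
    qed
  qed
qed

section \<open>The common kernel of the measurements\<close>

lemma subspace_Vperp: "subspace (Vperp m n \<phi>)"
  by (auto simp: Vperp_def subspace_def blinfun.bilinear_simps)

lemma closed_Vperp: "closed (Vperp m n \<phi>)"
proof -
  have "Vperp m n \<phi> = (\<Inter>i\<in>{1..m}. \<Inter>\<alpha>\<in>{1..n}. {\<psi>. blinfun_apply (\<phi> i \<alpha>) \<psi> = 0})"
    by (auto simp: Vperp_def)
  moreover have "closed {\<psi>. blinfun_apply f \<psi> = 0}" for f :: "'a \<Rightarrow>\<^sub>L real"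
    by (intro closed_Collect_eq continuous_intros)
  ultimately show ?thesis by (auto intro!: closed_INT)
qed

lemma measurement_span_Vperp_eq_0:
  assumes "g \<in> measurement_span m n \<phi>" "x \<in> Vperp m n \<phi>"
  shows "blinfun_apply g x = 0"
  using assms(1) unfolding measurement_span_def
proof (induction rule: span_induct_alt)
  case base
  then show ?case by simp
next
  case (step c f g)
  then show ?case using assms(2) by (auto simp: Vperp_def blinfun.bilinear_simps)
qed

lemma vanishing_on_Vperp_imp_measurement_span:
  assumes "subspace S" "\<And>x. x \<in> S \<inter> Vperp m n \<phi> \<Longrightarrow> blinfun_apply h x = 0"
  shows "\<exists>g\<in>measurement_span m n \<phi>. \<forall>x\<in>S. blinfun_apply h x = blinfun_apply g x"
proof -
  have "{\<phi> i \<alpha> | i \<alpha>. i \<in> {1..m} \<and> \<alpha> \<in> {1..n}} = (\<lambda>(i, \<alpha>). \<phi> i \<alpha>) ` ({1..m} \<times> {1..n})"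
    by force
  then show ?thesis
    unfolding measurement_span_def
    using vanishing_on_kernels_imp_span[of "{1..m} \<times> {1..n}" S "\<lambda>(i, \<alpha>). \<phi> i \<alpha>" h] assms
    by (auto simp: Vperp_def)
qed

lemma Sup_nonzero_eq_maximum:
  assumes "x \<in> S" "x \<noteq> 0" "f x = c" "\<And>y. y \<in> S \<Longrightarrow> y \<noteq> 0 \<Longrightarrow> f y \<le> c"
  shows "Sup_nonzero S f = c"
proof -
  have "(SUP x\<in>S - {0}. f x) = c"
    by (rule cSup_eq_maximum) (use assms in auto)
  then show ?thesis using assms(1,2) by (auto simp: Sup_nonzero_def)
qed

section \<open>The Hilbert space structure given by \<open>Q\<close>\<close>

text \<open>Through \<open>norm_eq\<close> and \<open>sym\<close> the form \<open>Qinner Q\<close>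
  is an inner product inducing the norm, and \<open>Q\<close> is the Riesz map from a functional to
  its representing vector.\<close>

locale riesz_operator =
  fixes Q :: "('b::banach \<Rightarrow>\<^sub>L real) \<Rightarrow> 'b"
  assumes lin: "linear Q" and bij: "bij Q"
    and sym: "blinfun_apply f (Q g) = blinfun_apply g (Q f)"
    and norm_eq: "(norm u)\<^sup>2 = blinfun_apply (inv Q u) u"
begin

abbreviation ip where "ip \<equiv> Qinner Q"

lemma inv_Q [simp]: "inv Q (Q f) = f" "Q (inv Q u) = u"
  using bij by (auto simp: bij_def surj_f_inv_f)

lemma ip_Q: "ip (Q f) u = blinfun_apply f u"
  by (simp add: Qinner_def)

lemma ip_sym: "ip u v = ip v u"
  using sym[of "inv Q u" "inv Q v"] by (simp add: Qinner_def)

lemma norm_ip: "(norm u)\<^sup>2 = ip u u"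
  by (simp add: norm_eq Qinner_def)

lemma ip_right: "ip u (v + w) = ip u v + ip u w" "ip u (v - w) = ip u v - ip u w"
  "ip u (c *\<^sub>R v) = c * ip u v" "ip u (sum v' I) = (\<Sum>i\<in>I. ip u (v' i))" "ip u 0 = 0"
  by (simp_all add: Qinner_def blinfun.bilinear_simps)

lemma ip_left: "ip (v + w) u = ip v u + ip w u" "ip (v - w) u = ip v u - ip w u"
  "ip (c *\<^sub>R v) u = c * ip v u" "ip 0 u = 0"
  by (simp_all add: ip_sym[of _ u] ip_right)

lemma parallelogram:
  fixes u v :: 'b
  shows "(norm (u + v))\<^sup>2 + (norm (u - v))\<^sup>2 = 2 * (norm u)\<^sup>2 + 2 * (norm v)\<^sup>2"
  by (simp add: norm_ip ip_left ip_right)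

lemma norm_diff_scaleR:
  fixes u v :: 'b
  shows "(norm (u - t *\<^sub>R v))\<^sup>2 = (norm u)\<^sup>2 - 2 * t * ip u v + t\<^sup>2 * (norm v)\<^sup>2"
  by (simp add: norm_ip ip_left ip_right ip_sym[of v u])
    (simp add: power2_eq_square algebra_simps)

lemma ip_squared_le: "(ip u v)\<^sup>2 \<le> (norm u)\<^sup>2 * (norm v)\<^sup>2"
proof (cases "v = 0")
  case False
  then have v: "(norm v)\<^sup>2 > 0" by simp
  \<comment> \<open>The coefficient minimises the quadratic \<open>norm_diff_scaleR\<close> in
    \<open>t\<close>; nonnegativity of the minimum is Cauchy-Schwarz.\<close>
  have "0 \<le> (norm (u - (ip u v / (norm v)\<^sup>2) *\<^sub>R v))\<^sup>2" by simp
  also have "\<dots> = (norm u)\<^sup>2 - (ip u v)\<^sup>2 / (norm v)\<^sup>2"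
    unfolding norm_diff_scaleR using v by (simp add: power2_eq_square field_simps)
  finally show ?thesis using v by (simp add: field_simps)
qed (simp add: ip_right)

lemma ip_le: "ip u v \<le> norm u * norm v"
  using ip_squared_le[of u v] by (intro power2_le_imp_le[of "ip u v"]) (simp_all add: power_mult_distrib)

section \<open>Orthogonal projection onto closed subspaces\<close>

lemma nearest_point_orthogonal:
  assumes S: "subspace S" "v \<in> S" "w \<in> S"
    and min: "\<And>x. x \<in> S \<Longrightarrow> (norm (u - v))\<^sup>2 \<le> (norm (u - x))\<^sup>2"
  shows "ip (u - v) w = 0"
proof (cases "w = 0")
  case False
  then have w: "(norm w)\<^sup>2 > 0" by simp
  \<comment> \<open>Moving \<open>v\<close> by the optimal multiple of \<open>w\<close> would lower
    the squared distance by \<open>(ip (u - v) w)\<^sup>2 / (norm w)\<^sup>2\<close>, so minimality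
    forces this to be 0.\<close>
  define t where "t = ip (u - v) w / (norm w)\<^sup>2"
  have "(norm (u - v))\<^sup>2 \<le> (norm (u - (v + t *\<^sub>R w)))\<^sup>2"
    by (intro min subspace_add subspace_scale S)
  also have "u - (v + t *\<^sub>R w) = (u - v) - t *\<^sub>R w" by simp
  also have "(norm \<dots>)\<^sup>2 = (norm (u - v))\<^sup>2 - (ip (u - v) w)\<^sup>2 / (norm w)\<^sup>2"
    unfolding norm_diff_scaleR using w by (simp add: t_def power2_eq_square field_simps)
  finally show ?thesis using w by (simp add: divide_le_0_iff)
qed (simp add: ip_right)

text \<open>A minimising sequence is Cauchy by the parallelogram law; completeness gives a limit,
  which lies in \<open>S\<close> by closedness.\<close>

lemma nearest_point_exists:
  fixes S :: "'b set"
  assumes S: "subspace S" "closed S"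
  shows "\<exists>v\<in>S. \<forall>x\<in>S. (norm (u - v))\<^sup>2 \<le> (norm (u - x))\<^sup>2"
proof -
  define d where "d = (INF x\<in>S. (norm (u - x))\<^sup>2)"
  have ne: "S \<noteq> {}" using S(1) subspace_0 by auto
  have bdd: "bdd_below ((\<lambda>x. (norm (u - x))\<^sup>2) ` S)" by (rule bdd_belowI2[of _ 0]) simp
  have d_le: "d \<le> (norm (u - x))\<^sup>2" if "x \<in> S" for x
    unfolding d_def by (rule cINF_lower[OF bdd that])
  have "\<exists>x\<in>S. (norm (u - x))\<^sup>2 < d + inverse (real (Suc k))" for k
    using cINF_less_iff[OF ne bdd, of "d + inverse (real (Suc k))"] by (simp add: d_def)
  then obtain x where x: "\<And>k. x k \<in> S" "\<And>k. (norm (u - x k))\<^sup>2 < d + inverse (real (Suc k))"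
    by metis
  have close: "(norm (x j - x k))\<^sup>2 \<le> 4 * inverse (real (Suc N))" if "j \<ge> N" "k \<ge> N" for j k N
  proof -
    \<comment> \<open>The midpoint is at squared distance at least \<open>d\<close> from
      \<open>u\<close>, so the sum term of the parallelogram law is at least \<open>4 * d\<close>.
      As both endpoints are nearly optimal, little is left for the difference term.\<close>
    have "(1/2) *\<^sub>R (x j + x k) \<in> S" by (intro subspace_scale subspace_add S x)
    from d_le[OF this] have "4 * d \<le> (norm (2 *\<^sub>R (u - (1/2) *\<^sub>R (x j + x k))))\<^sup>2"
      by (simp add: power_mult_distrib del: scaleR_right_diff_distrib)
    also have "2 *\<^sub>R (u - (1/2) *\<^sub>R (x j + x k)) = (u - x j) + (u - x k)"
      by (simp add: algebra_simps scaleR_2)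
    finally have "4 * d \<le> (norm ((u - x j) + (u - x k)))\<^sup>2" .
    moreover have "(norm (x j - x k))\<^sup>2 = (norm ((u - x j) - (u - x k)))\<^sup>2"
      by (simp add: norm_minus_commute)
    ultimately have "(norm (x j - x k))\<^sup>2 \<le> 2 * (norm (u - x j))\<^sup>2 + 2 * (norm (u - x k))\<^sup>2 - 4 * d"
      using parallelogram[of "u - x j" "u - x k"] by linarith
    also have "\<dots> \<le> 2 * inverse (real (Suc j)) + 2 * inverse (real (Suc k))"
      using x(2)[of j] x(2)[of k] by linarith
    also have "\<dots> \<le> 4 * inverse (real (Suc N))"
    proof -
      have "inverse (real (Suc i)) \<le> inverse (real (Suc N))" if "i \<ge> N" for i
        using that by (intro le_imp_inverse_le) auto
      from this[OF \<open>j \<ge> N\<close>] this[OF \<open>k \<ge> N\<close>] show ?thesis by linarith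
    qed
    finally show ?thesis .
  qed
  have "Cauchy x"
  proof (rule metric_CauchyI)
    fix e :: real assume "e > 0"
    then obtain N where N: "inverse (real (Suc N)) < e\<^sup>2 / 4"
      using reals_Archimedean[of "e\<^sup>2 / 4"] by auto
    have "dist (x j) (x k) < e" if "j \<ge> N" "k \<ge> N" for j k
      using close[OF that] N \<open>e > 0\<close>
      by (simp add: dist_norm) (rule power2_less_imp_less[of _ e], linarith+)
    then show "\<exists>M. \<forall>m\<ge>M. \<forall>n\<ge>M. dist (x m) (x n) < e" by blast
  qed
  then obtain v where v: "x \<longlonglongrightarrow> v" by (meson Cauchy_convergent convergentD)
  have "v \<in> S" using closed_sequentially[OF S(2) _ v] x by blast
  moreover have "(norm (u - v))\<^sup>2 \<le> d"
  proof (rule LIMSEQ_le)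
    show "(\<lambda>k. (norm (u - x k))\<^sup>2) \<longlonglongrightarrow> (norm (u - v))\<^sup>2" by (intro tendsto_intros v)
    show "(\<lambda>k. d + inverse (real (Suc k))) \<longlonglongrightarrow> d"
      using tendsto_add[OF tendsto_const LIMSEQ_inverse_real_of_nat, of d] by simp
    show "\<exists>N. \<forall>k\<ge>N. (norm (u - x k))\<^sup>2 \<le> d + inverse (real (Suc k))"
      using x(2) less_imp_le by blast
  qed
  ultimately show ?thesis using d_le by (meson order_trans)
qed

lemma orth_proj_eqI:
  assumes "subspace S" "v \<in> S" "\<And>w. w \<in> S \<Longrightarrow> ip (u - v) w = 0"
  shows "orth_proj Q S u = v"
  unfolding orth_proj_def
proof (rule the_equality)
  fix v' assume v': "v' \<in> S \<and> (\<forall>w\<in>S. ip (u - v') w = 0)"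
  \<comment> \<open>The difference lies in \<open>S\<close> and is orthogonal to both residuals,
    hence to their difference, which is the vector itself up to sign.\<close>
  then have "v' - v \<in> S" using assms by (simp add: subspace_diff)
  then have "ip (u - v) (v' - v) = 0" "ip (u - v') (v' - v) = 0" using v' assms(3) by auto
  then have "(norm (v' - v))\<^sup>2 = 0"
    by (simp add: norm_ip ip_left ip_right)
  then show "v' = v" by simp
qed (use assms in auto)

context
  fixes S :: "'b set" assumes S: "subspace S" "closed S"
begin

text \<open>The definite description in \<open>orth_proj\<close> denotes the nearest point: that
  point has an orthogonal residual, and \<open>orth_proj_eqI\<close> gives uniqueness.\<close>

lemma orth_proj_mem: "orth_proj Q S u \<in> S"
  and orth_proj_orthogonal: "w \<in> S \<Longrightarrow> ip (u - orth_proj Q S u) w = 0"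
proof -
  obtain v where v: "v \<in> S" "\<And>x. x \<in> S \<Longrightarrow> (norm (u - v))\<^sup>2 \<le> (norm (u - x))\<^sup>2"
    using nearest_point_exists[OF S, of u] by blast
  have orth: "ip (u - v) w = 0" if "w \<in> S" for w
    using nearest_point_orthogonal[OF S(1) v(1) that v(2)] .
  have "orth_proj Q S u = v"
    using orth_proj_eqI[OF S(1) v(1) orth] .
  then show "orth_proj Q S u \<in> S" "w \<in> S \<Longrightarrow> ip (u - orth_proj Q S u) w = 0"
    using v(1) orth by auto
qed

lemma ip_orth_proj: "w \<in> S \<Longrightarrow> ip (orth_proj Q S u) w = ip u w"
  using orth_proj_orthogonal[of w u] by (simp add: ip_left)

lemma ip_orth_proj_self: "ip u (orth_proj Q S u) = (norm (orth_proj Q S u))\<^sup>2"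
  using ip_orth_proj[OF orth_proj_mem] by (simp add: norm_ip)

lemma norm_orth_proj_le: "norm (orth_proj Q S u) \<le> norm u"
proof -
  have "norm (orth_proj Q S u) * norm (orth_proj Q S u) \<le> norm u * norm (orth_proj Q S u)"
    using ip_le[of u "orth_proj Q S u"] by (simp add: ip_orth_proj_self power2_eq_square)
  then show ?thesis
    by (cases "orth_proj Q S u = 0") auto
qed

lemma orth_proj_ident: "u \<in> S \<Longrightarrow> orth_proj Q S u = u"
  by (rule orth_proj_eqI[OF S(1)]) (auto simp: ip_left)

section \<open>Dual norms on subspaces as norms of projections\<close>

text \<open>Riesz representation inside \<open>S\<close>: the part of \<open>Q f\<close> orthogonal
  to \<open>S\<close> is invisible to vectors of \<open>S\<close>.\<close>

lemma apply_eq_ip_orth_proj: "x \<in> S \<Longrightarrow> blinfun_apply f x = ip (orth_proj Q S (Q f)) x"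
  by (simp add: ip_orth_proj ip_Q)

text \<open>Handles the degenerate cases once for both kinds of quotient. If \<open>p\<close> is 0,
  it is no candidate for the supremum; then either \<open>S\<close> is trivial and the default 0
  applies, or \<open>F\<close> is 0 on \<open>S\<close> and any nonzero vector attains it.\<close>

lemma Sup_nonzero_orth_proj:
  fixes u defines "p \<equiv> orth_proj Q S u"
  assumes zero: "\<And>x. x \<in> S \<Longrightarrow> p = 0 \<Longrightarrow> F x = 0"
    and le: "\<And>x. x \<in> S \<Longrightarrow> x \<noteq> 0 \<Longrightarrow> F x \<le> F p"
  shows "Sup_nonzero S F = F p"
proof -
  have p: "p \<in> S" unfolding p_def by (rule orth_proj_mem)
  consider "p \<noteq> 0" | "S - {0} = {}" "p = 0" | x where "x \<in> S" "x \<noteq> 0" "p = 0"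
    using p by blast
  then show ?thesis
  proof cases
    case 1
    then show ?thesis using le by (intro Sup_nonzero_eq_maximum[OF p]) auto
  next
    case 2
    then show ?thesis using zero[OF p] by (simp add: Sup_nonzero_def)
  next
    case 3
    then show ?thesis
      using zero p by (intro Sup_nonzero_eq_maximum[of x]) auto
  qed
qed

lemma quot_sup_eq: "quot_sup S f = (norm (orth_proj Q S (Q f)))\<^sup>2"
proof -
  let ?p = "orth_proj Q S (Q f)"
  \<comment> \<open>For \<open>?p = 0\<close> both sides are 0, since division by zero yields
    0.\<close>
  have p: "(blinfun_apply f ?p)\<^sup>2 / (norm ?p)\<^sup>2 = (norm ?p)\<^sup>2"
    by (cases "?p = 0") (simp_all add: apply_eq_ip_orth_proj[OF orth_proj_mem] power2_eq_square
        flip: norm_ip)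
  have "quot_sup S f = (blinfun_apply f ?p)\<^sup>2 / (norm ?p)\<^sup>2"
    unfolding quot_sup_def
  proof (rule Sup_nonzero_orth_proj)
    show "(blinfun_apply f x)\<^sup>2 / (norm x)\<^sup>2 \<le> (blinfun_apply f ?p)\<^sup>2 / (norm ?p)\<^sup>2"
      if "x \<in> S" "x \<noteq> 0" for x
      using ip_squared_le[of ?p x] that unfolding p
      by (simp add: apply_eq_ip_orth_proj[of x] divide_le_eq)
  qed (simp add: apply_eq_ip_orth_proj ip_left)
  then show ?thesis by (simp add: p)
qed

lemma sub_dual_norm_eq: "sub_dual_norm S (restr S f) = norm (orth_proj Q S (Q f))"
proof -
  let ?p = "orth_proj Q S (Q f)"
  have p: "restr S f ?p / norm ?p = norm ?p"
    by (simp add: restr_def orth_proj_mem apply_eq_ip_orth_proj[OF orth_proj_mem] flip: norm_ip)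
      (simp add: power2_eq_square)
  have "sub_dual_norm S (restr S f) = restr S f ?p / norm ?p"
    unfolding sub_dual_norm_def
  proof (rule Sup_nonzero_orth_proj)
    show "restr S f x / norm x \<le> restr S f ?p / norm ?p" if "x \<in> S" "x \<noteq> 0" for x
      using ip_le[of ?p x] that unfolding p
      by (simp add: restr_def apply_eq_ip_orth_proj[of x] divide_le_eq)
  qed (simp add: restr_def apply_eq_ip_orth_proj ip_left)
  then show ?thesis by (simp add: p)
qed

lemma sub_dual_norm_squared: "(sub_dual_norm S (restr S f))\<^sup>2 = quot_sup S f"
  by (simp add: sub_dual_norm_eq quot_sup_eq)

end

text \<open>Makes the outer terms of (b) the case \<open>S = UNIV\<close> of the middle ones, so
  that \<open>Inf_quot_sup\<close> covers all of them.\<close>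

lemma dual_norm_squared: "(dual_norm Q f)\<^sup>2 = quot_sup UNIV f"
proof -
  have "(dual_norm Q f)\<^sup>2 = (norm (Q f))\<^sup>2"
    by (simp add: dual_norm_def norm_ip ip_Q flip: ip_Q)
      (metis norm_ip zero_le_power2 real_sqrt_pow2)
  then show ?thesis by (simp add: quot_sup_eq orth_proj_ident)
qed

text \<open>Against vectors of \<open>T\<close>, both \<open>u\<close> and its projection onto
  \<open>S\<close> have the same inner products, and these determine the projection onto
  \<open>T\<close>.\<close>

lemma orth_proj_orth_proj:
  assumes "subspace S" "closed S" "subspace T" "closed T" "T \<subseteq> S"
  shows "orth_proj Q T (orth_proj Q S u) = orth_proj Q T u"
proof (rule orth_proj_eqI[OF assms(3) orth_proj_mem[OF assms(3,4)]])
  fix w assume "w \<in> T"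
  then show "ip (orth_proj Q S u - orth_proj Q T u) w = 0"
    using assms by (auto simp: ip_left ip_orth_proj)
qed

text \<open>Subtracting a measurement combination leaves \<open>f\<close> unchanged on
  \<open>S \<inter> Vperp m n \<phi>\<close>, which bounds the infimum from below; it is attained by
  cancelling everything in \<open>f\<close> on \<open>S\<close> except the functional represented by
  \<open>q\<close>.\<close>

lemma Inf_quot_sup:
  fixes S :: "'b set"
  assumes S: "subspace S" "closed S"
  shows "(INF g\<in>measurement_span m n \<phi>. quot_sup S (f - g)) = quot_sup (S \<inter> Vperp m n \<phi>) f"
proof -
  let ?T = "S \<inter> Vperp m n \<phi>"
  have T: "subspace ?T" "closed ?T"
    using S by (auto simp: subspace_inter subspace_Vperp closed_Vperp)
  define q where "q = orth_proj Q ?T (Q f)"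
  have q: "q \<in> S" using orth_proj_mem[OF T] by (simp add: q_def)
  \<comment> \<open>\<open>inv Q q\<close> is the functional represented by \<open>q\<close>, and it
    agrees with \<open>f\<close> on \<open>?T\<close>.\<close>
  have "blinfun_apply (f - inv Q q) x = 0" if "x \<in> ?T" for x
    using apply_eq_ip_orth_proj[OF T that, of f]
    by (simp add: blinfun.diff_left q_def Qinner_def)
  from vanishing_on_Vperp_imp_measurement_span[OF S(1) this]
  obtain g where g: "g \<in> measurement_span m n \<phi>"
    "\<And>x. x \<in> S \<Longrightarrow> blinfun_apply (f - inv Q q) x = blinfun_apply g x" by blast
  have "orth_proj Q S (Q (f - g)) = q"
  proof (rule orth_proj_eqI[OF S(1) q])
    show "ip (Q (f - g) - q) w = 0" if "w \<in> S" for w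
      using g(2)[OF that] by (simp add: ip_left ip_Q blinfun.diff_left) (simp add: Qinner_def)
  qed
  then have attained: "quot_sup S (f - g) = quot_sup ?T f"
    by (simp add: quot_sup_eq S T q_def)
  have lower: "quot_sup ?T f \<le> quot_sup S (f - g)" if g: "g \<in> measurement_span m n \<phi>" for g
  proof -
    have "quot_sup ?T f = quot_sup ?T (f - g)"
      unfolding quot_sup_def Sup_nonzero_def
      using measurement_span_Vperp_eq_0[OF g] by (auto simp: blinfun.diff_left intro!: SUP_cong)
    also have "\<dots> \<le> quot_sup S (f - g)"
      using norm_orth_proj_le[OF T, of "orth_proj Q S (Q (f - g))"] S T
      by (simp add: quot_sup_eq orth_proj_orth_proj power_mono)
    finally show ?thesis .
  qed
  show ?thesis
    by (rule cInf_eq_minimum) (use g(1) attained lower in \<open>force+\<close>)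
qed

end

section \<open>Existence of optimal constants\<close>

text \<open>The admissible constants form a nonempty closed set, bounded above by the quotient at
  one vector with \<open>N x > 0\<close>, so they contain their supremum.\<close>

lemma is_largest_exists:
  fixes F :: "'a \<Rightarrow> real"
  assumes "x \<in> V" "N x > 0" "\<And>x. x \<in> V \<Longrightarrow> c * N x \<le> F x"
  shows "\<exists>l. is_largest l (\<lambda>c. \<forall>x\<in>V. c * N x \<le> F x)"
proof -
  let ?A = "{c. \<forall>x\<in>V. c * N x \<le> F x}"
  have "bdd_above ?A"
    using assms(1,2) by (intro bdd_aboveI[of _ "F x / N x"]) (auto simp: le_divide_eq)
  moreover have "closed ?A"
    unfolding Ball_def by (intro closed_Collect_all closed_Collect_imp closed_Collect_le
        continuous_intros open_Collect_const)
  moreover have "?A \<noteq> {}" using assms(3) by auto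
  ultimately have "Sup ?A \<in> ?A" "\<forall>c\<in>?A. c \<le> Sup ?A"
    using closed_contains_Sup[of ?A] cSup_upper[of _ ?A] by blast+
  then show ?thesis by (auto simp: is_largest_def intro!: exI[of _ "Sup ?A"])
qed

lemma is_smallest_exists:
  fixes F :: "'a \<Rightarrow> real"
  assumes "x \<in> V" "N x > 0" "\<And>x. x \<in> V \<Longrightarrow> F x \<le> c * N x"
  shows "\<exists>l. is_smallest l (\<lambda>c. \<forall>x\<in>V. F x \<le> c * N x)"
proof -
  \<comment> \<open>Negating \<open>F\<close> and the constants turns smallest upper constants into
    largest lower ones.\<close>
  have "\<exists>l. is_largest l (\<lambda>c. \<forall>x\<in>V. c * N x \<le> - F x)"
    by (rule is_largest_exists[of x _ _ "-c"]) (use assms in auto)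
  then obtain l where l: "\<forall>x\<in>V. l * N x \<le> - F x"
    "\<And>c. \<forall>x\<in>V. c * N x \<le> - F x \<Longrightarrow> c \<le> l"
    unfolding is_largest_def by blast
  have "- l \<le> c" if "\<forall>x\<in>V. F x \<le> c * N x" for c
    using l(2)[of "- c"] that by auto
  then show ?thesis using l(1) by (force simp: is_smallest_def intro!: exI[of _ "- l"])
qed

section \<open>Reduction of (a) and (b) to the quadratic form of \<open>P\<close>\<close>

theorem theorem6p8:
  fixes Q :: "('b::banach \<Rightarrow>\<^sub>L real) \<Rightarrow> 'b"
    and m n :: nat
    and \<phi> :: "nat \<Rightarrow> nat \<Rightarrow> 'b \<Rightarrow>\<^sub>L real"
    and B :: "nat \<Rightarrow> 'b set"
  defines "V \<equiv> Vperp m n \<phi>"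
    and "\<Phi> \<equiv> measurement_span m n \<phi>"
    and "P \<equiv> Psum Q m n \<phi> B"
  assumes "reflexive_space TYPE('b)"
    and "separable TYPE('b)"
    and "linear Q" and "bij Q"
    and "\<forall>f g. blinfun_apply f (Q g) = blinfun_apply g (Q f)"
    and "\<forall>f. f \<noteq> 0 \<longrightarrow> blinfun_apply f (Q f) > 0"
    and "\<forall>u. (norm u)\<^sup>2 = blinfun_apply (inv Q u) u"
    and "indexed_independent (\<lambda>(i, \<alpha>). \<phi> i \<alpha>) ({1..m} \<times> {1..n})"
    and "\<forall>i\<in>{1..m}. subspace (B i) \<and> closed (B i)"
    and "\<forall>u. \<exists>v. (\<forall>i\<in>{1..m}. v i \<in> B i) \<and> u = (\<Sum>i\<in>{1..m}. v i)"
    and "\<forall>i\<in>{1..m}. \<forall>\<alpha>\<in>{1..n}. \<exists>\<psi>\<in>B i. \<forall>j\<in>{1..m}. \<forall>\<beta>\<in>{1..n}.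
           blinfun_apply (\<phi> j \<beta>) \<psi> = (if i = j \<and> \<alpha> = \<beta> then 1 else 0)"
  shows
    "(V \<noteq> {0} \<longrightarrow> (\<exists>l. is_lambda_min Q V P l) \<and> (\<exists>l. is_lambda_max Q V P l))
     \<and> (\<forall>l. is_lambda_min Q V P l \<longleftrightarrow>
            is_largest l (\<lambda>c. \<forall>f. c * quot_sup V f \<le> (\<Sum>i\<in>{1..m}. quot_sup (B i \<inter> V) f)))
     \<and> (\<forall>l. is_lambda_max Q V P l \<longleftrightarrow>
            is_smallest l (\<lambda>c. \<forall>f. (\<Sum>i\<in>{1..m}. quot_sup (B i \<inter> V) f) \<le> c * quot_sup V f))
     \<and> (\<forall>l. is_lambda_min Q V P l \<longleftrightarrow>
            is_largest l (\<lambda>c. \<forall>f.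
              c * (INF g\<in>\<Phi>. (dual_norm Q (f - g))\<^sup>2)
                \<le> (\<Sum>i\<in>{1..m}. INF g\<in>\<Phi>. (sub_dual_norm (B i) (restr (B i) (f - g)))\<^sup>2)))
     \<and> (\<forall>l. is_lambda_max Q V P l \<longleftrightarrow>
            is_smallest l (\<lambda>c. \<forall>f.
              (\<Sum>i\<in>{1..m}. INF g\<in>\<Phi>. (sub_dual_norm (B i) (restr (B i) (f - g)))\<^sup>2)
                \<le> c * (INF g\<in>\<Phi>. (dual_norm Q (f - g))\<^sup>2)))"
proof -
  interpret riesz_operator Q
    by (rule riesz_operator.intro)
      (rule assms(6,7) assms(8)[rule_format] assms(10)[rule_format])+
  have V: "subspace V" "closed V"
    by (auto simp: V_def subspace_Vperp closed_Vperp)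
  have B: "subspace (B i)" "closed (B i)" if "i \<in> {1..m}" for i
    using assms(12) that by (metis One_nat_def)+
  have BV: "subspace (B i \<inter> V)" "closed (B i \<inter> V)" if "i \<in> {1..m}" for i
    using B[OF that] V by (auto simp: subspace_inter)
  have ipP: "ip x (P x) = (\<Sum>i\<in>{1..m}. (norm (orth_proj Q (B i \<inter> V) x))\<^sup>2)" for x
    by (simp add: P_def Psum_def ip_right ip_orth_proj_self BV flip: V_def)
  have quot_V: "quot_sup V f = (norm (orth_proj Q V (Q f)))\<^sup>2" for f
    by (rule quot_sup_eq[OF V])
  \<comment> \<open>Since \<open>B i \<inter> V\<close> lies in \<open>V\<close>, projecting
    \<open>Q f\<close> onto \<open>V\<close> first does not change the projection onto it.\<close>
  have quot_BV: "(\<Sum>i\<in>{1..m}. quot_sup (B i \<inter> V) f)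
      = ip (orth_proj Q V (Q f)) (P (orth_proj Q V (Q f)))" for f
    unfolding ipP by (intro sum.cong refl) (simp add: quot_sup_eq BV orth_proj_orth_proj V)
  have dual: "(INF g\<in>\<Phi>. (dual_norm Q (f - g))\<^sup>2) = quot_sup V f" for f
    using Inf_quot_sup[of UNIV f m n \<phi>] by (simp add: dual_norm_squared V_def \<Phi>_def)
  have dual_B: "(\<Sum>i\<in>{1..m}. INF g\<in>\<Phi>. (sub_dual_norm (B i) (restr (B i) (f - g)))\<^sup>2)
      = (\<Sum>i\<in>{1..m}. quot_sup (B i \<inter> V) f)" for f
    by (intro sum.cong refl) (simp add: sub_dual_norm_squared B Inf_quot_sup V_def \<Phi>_def)
  \<comment> \<open>The projections of \<open>Q f\<close> exhaust \<open>V\<close>: a vector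
    \<open>x\<close> of \<open>V\<close> comes from \<open>f = inv Q x\<close>. This trades the
    quantifier over \<open>V\<close> for one over functionals.\<close>
  have all_V: "(\<forall>x\<in>V. R x) \<longleftrightarrow> (\<forall>f. R (orth_proj Q V (Q f)))" for R
  proof
    assume R: "\<forall>f. R (orth_proj Q V (Q f))"
    show "\<forall>x\<in>V. R x"
    proof
      fix x assume "x \<in> V"
      then show "R x"
        using R[rule_format, of "inv Q x"] by (simp add: orth_proj_ident[OF V])
    qed
  qed (use orth_proj_mem[OF V] in blast)
  \<comment> \<open>Each of the \<open>m\<close> projections is a contraction, so \<open>m\<close>
    is an admissible upper constant; 0 is an admissible lower one.\<close>
  have ipP_le: "ip x (P x) \<le> real m * (norm x)\<^sup>2" for x
  proof -
    have "ip x (P x) \<le> (\<Sum>i\<in>{1..m}. (norm x)\<^sup>2)"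
      unfolding ipP by (intro sum_mono power_mono norm_orth_proj_le BV) auto
    then show ?thesis by simp
  qed
  have ex: "(\<exists>l. is_lambda_min Q V P l) \<and> (\<exists>l. is_lambda_max Q V P l)" if nontriv: "V \<noteq> {0}"
  proof -
    obtain x where x: "x \<in> V" "x \<noteq> 0" using nontriv subspace_0[OF V(1)] by blast
    show ?thesis unfolding is_lambda_min_def is_lambda_max_def
      using is_largest_exists[of x V "\<lambda>x. (norm x)\<^sup>2" 0 "\<lambda>x. ip x (P x)"]
        is_smallest_exists[of x V "\<lambda>x. (norm x)\<^sup>2" "\<lambda>x. ip x (P x)" m] x ipP_le
      by (auto simp: ipP sum_nonneg)
  qed
  show ?thesis
    \<comment> \<open>These rewrites turn (b) into (a); the next ones give the defining conditions
      of the extreme constants the same form, so each equivalence becomes an identity.\<close>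
    unfolding dual dual_B
    unfolding is_lambda_min_def is_lambda_max_def all_V quot_BV quot_V
    using ex[unfolded is_lambda_min_def is_lambda_max_def all_V] by blast
qed

end
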